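(* Let $R$ be a finite commutative ring with unity and let $\Gamma'(R)$ be the unity product graph associated with $R$. Then $gr(\Gamma'(R))=\infty$.
   Context: For a ring $R$ with unity $e$, let $U(R)$ denote the set of units of $R$. The unity product graph $\Gamma'(R)$ is the simple graph with vertex set $U(R)$ in which two distinct vertices $r_i,r_j$ are adjacent if and only if $r_i\cdot r_j=e$. The girth $gr(\Gamma)$ of a graph $\Gamma$ is the length of a shortest cycle contained in $\Gamma$, with $gr(\Gamma)=\infty$ if $\Gamma$ contains no cycle. *)

theory Defs
  imports
    "HOL-Algebra.Ring"
    "HOL-Library.Extended_Nat"
    "Graph_Theory.Pair_Digraph"
begin

text \<open>
  A simple graph is a symmetric loop-free digraph whose arcs are pairs of vertices, an edge
  being represented by its two orientations.
\<close>

definition unity_product_graph :: "('a, 'b) ring_scheme \<Rightarrow> 'a pair_pre_digraph" where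
  "unity_product_graph R =
    \<lparr> pverts = Units R,
      parcs = {(r, s). r \<in> Units R \<and> s \<in> Units R \<and> r \<noteq> s \<and> r \<otimes>\<^bsub>R\<^esub> s = \<one>\<^bsub>R\<^esub>} \<rparr>"

text \<open>
  In a symmetric digraph, walking along an edge and straight back is a directed cycle of
  length 2. The cycles of the undirected graph are the directed cycles of length at least 3.
\<close>

definition graph_cycle :: "'a pair_pre_digraph \<Rightarrow> ('a \<times> 'a) list \<Rightarrow> bool" where
  "graph_cycle G p \<longleftrightarrow> pre_digraph.cycle (with_proj G) p \<and> 3 \<le> length p"

text \<open>The infimum over the empty set is \<open>\<infinity>\<close>, so an acyclic graph has girth \<open>\<infinity>\<close>.\<close>

definition girth :: "'a pair_pre_digraph \<Rightarrow> enat" where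
  "girth G = (INF p \<in> {p. graph_cycle G p}. enat (length p))"

lemma pair_graph_unity_product_graph:
  assumes "ring R" and "finite (carrier R)"
  shows "pair_graph (unity_product_graph R)"
proof -
  interpret ring R by fact
  have fin: "finite (Units R)"
    using assms(2) by (rule finite_subset[rotated]) (auto simp: Units_def)
  have comm: "s \<otimes>\<^bsub>R\<^esub> r = \<one>\<^bsub>R\<^esub>"
    if "r \<in> Units R" "s \<in> Units R" "r \<otimes>\<^bsub>R\<^esub> s = \<one>\<^bsub>R\<^esub>" for r s
    using Units_inv_comm[OF that(3,1,2)] .
  show ?thesis
  proof
    show "finite (parcs (unity_product_graph R))"
      by (rule finite_subset[of _ "Units R \<times> Units R"])
        (auto simp: unity_product_graph_def fin)
    show "symmetric (with_proj (unity_product_graph R))"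
      by (auto simp: unity_product_graph_def symmetric_def sym_def comm)
  qed (auto simp: unity_product_graph_def fin)
qed

lemma girth_eq_infinity_iff: "girth G = \<infinity> \<longleftrightarrow> (\<nexists>p. graph_cycle G p)"
  by (simp add: girth_def INF_top_conv flip: top_enat_def) (simp add: top_enat_def)

lemma girth_eq_enat_iff:
  "girth G = enat n \<longleftrightarrow>
    (\<exists>p. graph_cycle G p \<and> length p = n) \<and> (\<forall>p. graph_cycle G p \<longrightarrow> n \<le> length p)"
proof
  assume n: "girth G = enat n"
  then obtain p where "graph_cycle G p"
    using girth_eq_infinity_iff[of G] by auto
  then have "girth G \<in> (\<lambda>p. enat (length p)) ` {p. graph_cycle G p}"
    unfolding girth_def by (intro wellorder_InfI[of "enat (length p)"]) simp
  moreover have "girth G \<le> enat (length p)" if "graph_cycle G p" for p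
    unfolding girth_def using that by (intro INF_lower) simp
  ultimately show "(\<exists>p. graph_cycle G p \<and> length p = n) \<and> (\<forall>p. graph_cycle G p \<longrightarrow> n \<le> length p)"
    using n by auto
next
  assume "(\<exists>p. graph_cycle G p \<and> length p = n) \<and> (\<forall>p. graph_cycle G p \<longrightarrow> n \<le> length p)"
  then show "girth G = enat n"
    unfolding girth_def by (intro antisym INF_greatest) (auto intro: INF_lower2)
qed

end

theory Submission
  imports Defs
begin

text \<open>
  A unit has exactly one inverse, so every vertex of the unity product graph has at most one
  neighbour: the edges form a matching. Each vertex of a cycle of length at least 3, however,
  has two distinct neighbours along the cycle. Hence there is no such cycle.
\<close>

text \<open>
  A left inverse and a right inverse of \<open>s\<close> coincide, so a walk in the graph that arrives at
  \<open>s\<close> can only leave along the edge by which it came.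
\<close>

lemma unity_product_graph_walk_turns_back:
  assumes "ring R"
    and "(r, s) \<in> parcs (unity_product_graph R)"
    and "(s, t) \<in> parcs (unity_product_graph R)"
  shows "r = t"
proof -
  interpret ring R by fact
  have "r \<in> carrier R" "s \<in> carrier R" "t \<in> carrier R"
    and "r \<otimes>\<^bsub>R\<^esub> s = \<one>\<^bsub>R\<^esub>" "s \<otimes>\<^bsub>R\<^esub> t = \<one>\<^bsub>R\<^esub>"
    using assms(2,3) by (auto simp: unity_product_graph_def)
  then show ?thesis
    by (metis inv_unique)
qed

text \<open>
  If a walk always has to turn straight back, then its first three arcs are
  \<open>(u, v)\<close>, \<open>(v, u)\<close>, \<open>(u, v)\<close>. The vertices of a cycle are distinct apart from its starting
  point, so it cannot pass through \<open>v\<close> twice like this.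
\<close>

lemma no_graph_cycle_if_walks_turn_back:
  assumes turn: "\<And>u v w. (u, v) \<in> parcs G \<Longrightarrow> (v, w) \<in> parcs G \<Longrightarrow> u = w"
  shows "\<not> graph_cycle G p"
proof
  assume "graph_cycle G p"
  then obtain u where walk: "pre_digraph.awalk (with_proj G) u p u"
    and dist: "distinct (tl (pre_digraph.awalk_verts (with_proj G) u p))"
    and len: "3 \<le> length p"
    by (auto simp: graph_cycle_def pre_digraph.cycle_def)
  from len obtain a b c q where p: "p = a # b # c # q"
    by (auto simp: numeral_3_eq_3 Suc_le_length_iff)
  have "snd a = fst b" "snd b = fst c" "{a, b, c} \<subseteq> parcs G"
    using walk by (auto simp: p pre_digraph.awalk_def pre_digraph.cas.simps)
  then have "snd a = snd c"
    using turn[of "fst b" "snd b" "snd c"] by (cases a; cases b; cases c) auto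
  \<comment> \<open>The distinctness condition drops the first vertex, so what remains begins with the
      tails of \<open>b\<close> and \<open>c\<close> and then the head of \<open>c\<close>.\<close>
  moreover have "snd a \<noteq> snd c"
    using dist \<open>snd a = fst b\<close> walk
    by (cases q) (auto simp: p pre_digraph.awalk_verts.simps pre_digraph.awalk_def
        pre_digraph.cas.simps)
  ultimately show False by contradiction
qed

theorem theorem4p1:
  fixes R :: "('a, 'b) ring_scheme"
  assumes "cring R" and "finite (carrier R)"
  shows "girth (unity_product_graph R) = \<infinity>"
proof -
  have "ring R"
    using assms(1) by (rule cring.axioms)
  then have "\<not> graph_cycle (unity_product_graph R) p" for p
    by (intro no_graph_cycle_if_walks_turn_back unity_product_graph_walk_turns_back)
  then show ?thesis
    by (simp add: girth_eq_infinity_iff)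
qed

end
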